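(* Let $(X_{\mathbf{a},\mathbf{b}},0)$ and $(X_{\mathbf{c},\mathbf{d}},0)$ be two mixed Pham-Brieskorn surface germs of type (1) (as defined in the context) such that $a_1\ge 2$ and $\mu_{\mathbf{c},\mathbf{d}}<\mu_{\mathbf{a},\mathbf{b}}$. Then there does not exist a subanalytic bi-Lipschitz homeomorphism $\phi:(X_{\mathbf{a},\mathbf{b}},0)\to(X_{\mathbf{c},\mathbf{d}},0)$.
   Context: For integers $1\le a_1\le a_2$ and $b_1,b_2\ge 0$, put $f_{\mathbf{a},\mathbf{b}}(z_1,z_2)=z_1^{a_1+b_1}\overline{z}_1^{\,b_1}+z_2^{a_2+b_2}\overline{z}_2^{\,b_2}$; the mixed Pham-Brieskorn surface is the germ at $0$ of $X_{\mathbf{a},\mathbf{b}}=f_{\mathbf{a},\mathbf{b}}^{-1}(0)\subset\mathbb{C}^2=\mathbb{R}^4$, and $\mu_{\mathbf{a},\mathbf{b}}=\frac{a_2+2b_2}{a_1+2b_1}$. The surface is of type (1) if $a_1\ge 1$ and $\mu_{\mathbf{a},\mathbf{b}}>1$. Standing assumptions: the cases $(a_1,b_1)=(1,0)$ and $(a_2,b_2)=(1,0)$ are excluded, and $\gcd(a_1,a_2)=1$ for surfaces of type (1). The same conventions apply to $(\mathbf{c},\mathbf{d})$. Bi-Lipschitz is with respect to the outer metric, i.e. the restriction of the Euclidean distance; a map is subanalytic if its graph is a subanalytic set. *)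

theory Defs
  imports "HOL-Analysis.Analysis"
begin

text \<open>
  Semianalytic and subanalytic sets.  The number of auxiliary coordinates in a subanalytic set
  is existentially quantified, so \<open>\<real>\<^sup>k\<close> is rendered by \<^const>\<open>Euclidean_space\<close>, whose points are the
  sequences \<open>nat \<Rightarrow> real\<close> vanishing from index \<open>k\<close> on.
\<close>

text \<open>
  Locally, \<open>f\<close> is the sum of a convergent power series in \<open>k\<close> variables; the summation is
  unconditional, and the multi-indices are the \<open>\<alpha> :: nat \<Rightarrow> nat\<close> that vanish from index \<open>k\<close> on.
\<close>
definition real_analytic_at :: "nat \<Rightarrow> ((nat \<Rightarrow> real) \<Rightarrow> real) \<Rightarrow> (nat \<Rightarrow> real) \<Rightarrow> bool" where
  "real_analytic_at k f p \<longleftrightarrow>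
     (\<exists>r>0. \<exists>c :: (nat \<Rightarrow> nat) \<Rightarrow> real.
        \<forall>x \<in> topspace (Euclidean_space k). (\<forall>i<k. \<bar>x i - p i\<bar> < r) \<longrightarrow>
          ((\<lambda>\<alpha>. c \<alpha> * (\<Prod>i<k. (x i - p i) ^ \<alpha> i)) has_sum f x) {\<alpha>. \<forall>i\<ge>k. \<alpha> i = 0})"

definition real_analytic_on :: "nat \<Rightarrow> ((nat \<Rightarrow> real) \<Rightarrow> real) \<Rightarrow> (nat \<Rightarrow> real) set \<Rightarrow> bool" where
  "real_analytic_on k f U \<longleftrightarrow> (\<forall>p\<in>U. real_analytic_at k f p)"

text \<open>
  In a neighbourhood of every point of \<open>\<real>\<^sup>k\<close> (not only of \<open>A\<close>), the set \<open>A\<close> is a finite union of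
  sets given by finitely many analytic equations \<open>f = 0\<close>, \<open>f \<in> F\<close>, and strict inequalities
  \<open>g > 0\<close>, \<open>g \<in> G\<close>.
\<close>
definition semianalytic :: "nat \<Rightarrow> (nat \<Rightarrow> real) set \<Rightarrow> bool" where
  "semianalytic k A \<longleftrightarrow>
     A \<subseteq> topspace (Euclidean_space k) \<and>
     (\<forall>p \<in> topspace (Euclidean_space k). \<exists>U. openin (Euclidean_space k) U \<and> p \<in> U \<and>
        (\<exists>\<S>. finite \<S> \<and>
           (\<forall>(F, G) \<in> \<S>. finite F \<and> finite G \<and> (\<forall>f \<in> F \<union> G. real_analytic_on k f U)) \<and>
           A \<inter> U = {x \<in> U. \<exists>(F, G) \<in> \<S>. (\<forall>f\<in>F. f x = 0) \<and> (\<forall>g\<in>G. g x > 0)}))"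

definition first_coords :: "nat \<Rightarrow> (nat \<Rightarrow> real) \<Rightarrow> nat \<Rightarrow> real" where
  "first_coords n x = (\<lambda>i. if i < n then x i else 0)"

text \<open>
  In a neighbourhood of every point of \<open>\<real>\<^sup>n\<close>, the set \<open>A\<close> is the projection of a relatively compact
  semianalytic subset \<open>B\<close> of some \<open>\<real>\<^sup>n \<times> \<real>\<^sup>m = \<real>\<^bsup>n+m\<^esup>\<close>.
\<close>
definition subanalytic :: "nat \<Rightarrow> (nat \<Rightarrow> real) set \<Rightarrow> bool" where
  "subanalytic n A \<longleftrightarrow>
     A \<subseteq> topspace (Euclidean_space n) \<and>
     (\<forall>p \<in> topspace (Euclidean_space n). \<exists>U. openin (Euclidean_space n) U \<and> p \<in> U \<and>
        (\<exists>m B. semianalytic (n + m) B \<and>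
           (\<exists>K. compactin (Euclidean_space (n + m)) K \<and> B \<subseteq> K) \<and>
           A \<inter> U = first_coords n ` B))"

text \<open>The identification \<open>\<complex>\<^sup>2 \<times> \<complex>\<^sup>2 = \<real>\<^sup>8\<close>.\<close>
definition real_coords :: "(complex \<times> complex) \<times> (complex \<times> complex) \<Rightarrow> nat \<Rightarrow> real" where
  "real_coords = (\<lambda>((z1, z2), (w1, w2)) i.
     if i < 8 then [Re z1, Im z1, Re z2, Im z2, Re w1, Im w1, Re w2, Im w2] ! i else 0)"

definition subanalytic_map_on ::
    "(complex \<times> complex) set \<Rightarrow> (complex \<times> complex \<Rightarrow> complex \<times> complex) \<Rightarrow> bool" where
  "subanalytic_map_on S \<phi> \<longleftrightarrow> subanalytic 8 (real_coords ` {(x, \<phi> x) | x. x \<in> S})"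

definition bilipschitz_homeomorphism ::
    "'a::metric_space set \<Rightarrow> 'b::metric_space set \<Rightarrow> ('a \<Rightarrow> 'b) \<Rightarrow> bool" where
  "bilipschitz_homeomorphism S T \<phi> \<longleftrightarrow>
     (\<exists>\<psi> L M. homeomorphism S T \<phi> \<psi> \<and> L-lipschitz_on S \<phi> \<and> M-lipschitz_on T \<psi>)"

text \<open>
  The map \<open>\<phi>\<close> represents a subanalytic bi-Lipschitz homeomorphism of germs \<open>(X, 0) \<rightarrow> (Y, 0)\<close>: it
  restricts to such a map between neighbourhoods of \<open>0\<close> in \<open>X\<close> and in \<open>Y\<close>.  The distance on
  \<open>complex \<times> complex\<close> is the Euclidean one, so the metric is the outer one.
\<close>
definition subanalytic_bilipschitz_germ_homeomorphism ::
    "(complex \<times> complex) set \<Rightarrow> (complex \<times> complex) set \<Rightarrow>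
      (complex \<times> complex \<Rightarrow> complex \<times> complex) \<Rightarrow> bool" where
  "subanalytic_bilipschitz_germ_homeomorphism X Y \<phi> \<longleftrightarrow>
     (\<exists>U V. open U \<and> 0 \<in> U \<and> open V \<and> 0 \<in> V \<and> \<phi> 0 = 0 \<and>
        bilipschitz_homeomorphism (X \<inter> U) (Y \<inter> V) \<phi> \<and> subanalytic_map_on (X \<inter> U) \<phi>)"

text \<open>Mixed Pham-Brieskorn surfaces; the argument order is \<open>a\<^sub>1 a\<^sub>2 b\<^sub>1 b\<^sub>2\<close>.\<close>

definition mixed_PB_poly ::
    "nat \<Rightarrow> nat \<Rightarrow> nat \<Rightarrow> nat \<Rightarrow> complex \<times> complex \<Rightarrow> complex" where
  "mixed_PB_poly a1 a2 b1 b2 = (\<lambda>(z1, z2).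
     z1 ^ (a1 + b1) * cnj z1 ^ b1 + z2 ^ (a2 + b2) * cnj z2 ^ b2)"

definition mixed_PB_surface :: "nat \<Rightarrow> nat \<Rightarrow> nat \<Rightarrow> nat \<Rightarrow> (complex \<times> complex) set" where
  "mixed_PB_surface a1 a2 b1 b2 = {z. mixed_PB_poly a1 a2 b1 b2 z = 0}"

definition mixed_PB_mu :: "nat \<Rightarrow> nat \<Rightarrow> nat \<Rightarrow> nat \<Rightarrow> real" where
  "mixed_PB_mu a1 a2 b1 b2 = real (a2 + 2 * b2) / real (a1 + 2 * b1)"

text \<open>Type (1), including the standing assumptions on the exponents.\<close>
definition mixed_PB_type1 :: "nat \<Rightarrow> nat \<Rightarrow> nat \<Rightarrow> nat \<Rightarrow> bool" where
  "mixed_PB_type1 a1 a2 b1 b2 \<longleftrightarrow>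
     1 \<le> a1 \<and> a1 \<le> a2 \<and> (a1, b1) \<noteq> (1, 0) \<and> (a2, b2) \<noteq> (1, 0) \<and>
     mixed_PB_mu a1 a2 b1 b2 > 1 \<and> gcd a1 a2 = 1"

end

theory Submission
  imports Defs
begin

text \<open>
  Over the punctured \<open>z\<^sub>2\<close>-plane, the surface with exponents \<open>a\<^sub>1, a\<^sub>2, b\<^sub>1, b\<^sub>2\<close> is an
  \<open>a\<^sub>1\<close>-sheeted covering: the defining equation fixes the modulus \<open>\<bar>z\<^sub>1\<bar> = \<bar>z\<^sub>2\<bar> powr \<mu>\<close> and leaves
  \<open>a\<^sub>1\<close> equally spaced values for the argument of \<open>z\<^sub>1\<close>.  At distance \<open>r\<close> from the origin, different
  sheets over the same point are therefore at a mutual distance comparable to \<open>r powr \<mu>\<close>, which is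
  much smaller than \<open>r\<close> when \<open>\<mu> > 1\<close>; to pass from one sheet to another inside the surface, however,
  \<open>z\<^sub>2\<close> has to turn around \<open>0\<close>, so that one moves by at least \<open>r\<close>
  (\<open>connected_same_sheet\<close>).  The outer metric sees the exponent \<open>\<mu>\<close> through this contrast.

  Let \<open>\<mu>\<close> and \<open>\<nu>\<close> be the exponents of the source and the target, \<open>1 \<le> \<nu> < \<mu>\<close>, and
  let \<open>\<phi>\<close> be a bi-Lipschitz germ between them.  As \<open>a\<^sub>1 \<ge> 2\<close>, for every small \<open>r > 0\<close> there are two
  different points \<open>p, p'\<close> of the source over \<open>z\<^sub>2 = r\<close>, at distance at most \<open>2 r powr \<mu>\<close>
  (\<open>two_sheets\<close>).  Their images are at distance \<open>O(r powr \<mu>)\<close> from each other and at a distance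
  comparable to \<open>r\<close> from the origin, where the sheets of the target are separated by a multiple of
  \<open>r powr \<nu>\<close>.  Since \<open>r powr \<mu> = o(r powr \<nu>)\<close>, both images lie on the same local sheet of the target
  and are joined there by a connected set whose diameter is a small multiple of \<open>r\<close>
  (\<open>close_points_connected\<close>).  The inverse of \<open>\<phi>\<close> carries this set to a connected subset of the
  source that contains \<open>p\<close> and \<open>p'\<close> and stays within \<open>r / 2\<close> of \<open>p\<close>, hence in the half-space
  \<open>Re z\<^sub>2 > 0\<close>.  So \<open>p\<close> and \<open>p'\<close> are on the same sheet, which forces \<open>p = p'\<close>.
\<close>

section \<open>Mixed monomials and the modulus on the surface\<close>

definition mixed_power :: "nat \<Rightarrow> nat \<Rightarrow> complex \<Rightarrow> complex" where
  "mixed_power a b z = z ^ (a + b) * cnj z ^ b"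

lemma mem_mixed_PB_surface_iff:
  "(z1, z2) \<in> mixed_PB_surface a1 a2 b1 b2 \<longleftrightarrow> mixed_power a1 b1 z1 = - mixed_power a2 b2 z2"
  by (simp add: mixed_PB_surface_def mixed_PB_poly_def mixed_power_def eq_neg_iff_add_eq_0)

lemma mixed_power_mult: "mixed_power a b (x * y) = mixed_power a b x * mixed_power a b y"
  by (simp add: mixed_power_def power_mult_distrib)

lemma norm_mixed_power: "norm (mixed_power a b z) = norm z ^ (a + 2 * b)"
  by (simp add: mixed_power_def norm_mult norm_power mult_2 flip: power_add add.assoc)

lemma mixed_power_eq_0_iff: "a + 2 * b > 0 \<Longrightarrow> mixed_power a b z = 0 \<longleftrightarrow> z = 0"
  by (auto simp: mixed_power_def)

text \<open>
  In polar coordinates the modulus is raised to the power \<open>a + 2 b\<close>, whereas the argument is multiplied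
  only by \<open>a\<close>, because the \<open>b\<close> extra factors \<open>z\<close> cancel the rotation of the \<open>b\<close> factors \<open>cnj z\<close>.
\<close>
lemma mixed_power_polar:
  "mixed_power a b (of_real s * cis t) = of_real (s ^ (a + 2 * b)) * cis (real a * t)"
proof -
  have "cis t * cnj (cis t) = 1"
    by (simp add: cis_cnj cis_mult)
  hence "cis t ^ b * cnj (cis t) ^ b = 1"
    by (metis power_mult_distrib power_one)
  hence "mixed_power a b (cis t) = cis (real a * t)"
    by (simp only: mixed_power_def power_add mult.assoc mult_1_right Complex.DeMoivre)
  moreover have "mixed_power a b (of_real s) = of_real (s ^ (a + 2 * b))"
    by (simp add: mixed_power_def mult_2 flip: power_add add.assoc)
  ultimately show ?thesis
    by (simp add: mixed_power_mult)
qed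

text \<open>
  On the unit circle the mixed monomial is the ordinary power \<open>z ^ a\<close>.  This finiteness makes the
  sheets of the surface discrete, which is used both to keep a connected set on one sheet and to
  separate the sheets quantitatively.
\<close>
lemma finite_mixed_power_roots:
  assumes "a > 0" and "c \<noteq> 0"
  shows "finite {z. norm z = 1 \<and> mixed_power a b z = c}"
proof (rule finite_subset)
  show "{z. norm z = 1 \<and> mixed_power a b z = c} \<subseteq> {z. z ^ a = c}"
  proof clarify
    fix z :: complex assume z: "norm z = 1"
    have "z * cnj z = 1"
      using z by (simp add: complex_norm_square[symmetric])
    hence "z ^ b * cnj z ^ b = 1"
      by (metis power_mult_distrib power_one)
    thus "z ^ a = mixed_power a b z"
      by (simp add: mixed_power_def power_add mult.assoc)
  qed
  show "finite {z :: complex. z ^ a = c}"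
    using assms by (intro finite_nth_roots) auto
qed

lemma norm_fst_eq_powr:
  assumes "(z1, z2) \<in> mixed_PB_surface a1 a2 b1 b2" and "a1 > 0" and "a2 > 0"
  shows "norm z1 = norm z2 powr mixed_PB_mu a1 a2 b1 b2"
proof (cases "z2 = 0")
  case True
  with assms have "mixed_power a1 b1 z1 = 0"
    by (simp add: mem_mixed_PB_surface_iff mixed_power_def)
  with True assms show ?thesis
    by (simp add: mixed_power_eq_0_iff)
next
  case False
  have "norm z1 ^ (a1 + 2 * b1) = norm z2 ^ (a2 + 2 * b2)"
    using assms(1) by (simp add: mem_mixed_PB_surface_iff flip: norm_mixed_power)
  also have "\<dots> = (norm z2 powr mixed_PB_mu a1 a2 b1 b2) ^ (a1 + 2 * b1)"
    using False assms(2) by (simp add: mixed_PB_mu_def powr_powr powr_realpow [symmetric])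
  finally show ?thesis
    using assms(2) by (simp add: power_eq_iff_eq_base)
qed

section \<open>The sheets of the surface\<close>

text \<open>
  A branch on the plane cut along the negative real axis of the many-valued function that solves
  \<open>mixed_power a1 b1 w = mixed_power a2 b2 v\<close> for \<open>w\<close>; for \<open>b1 = b2 = 0\<close> it is the principal branch of
  \<open>v powr (a2 / a1)\<close>.  It is used twice: \<open>w\<^sub>1 = sheet_root w\<^sub>2\<close> parametrises a sheet up to a constant
  factor of modulus 1, and multiplication by \<open>(sheet_root v, v)\<close> maps the surface to itself.
\<close>
definition sheet_root :: "nat \<Rightarrow> nat \<Rightarrow> nat \<Rightarrow> nat \<Rightarrow> complex \<Rightarrow> complex" where
  "sheet_root a1 a2 b1 b2 v =
     of_real (norm v powr mixed_PB_mu a1 a2 b1 b2) * cis (real a2 / real a1 * Arg v)"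

lemma mixed_power_sheet_root:
  assumes "v \<noteq> 0" and "a1 > 0"
  shows "mixed_power a1 b1 (sheet_root a1 a2 b1 b2 v) = mixed_power a2 b2 v"
proof -
  have "(norm v powr mixed_PB_mu a1 a2 b1 b2) ^ (a1 + 2 * b1) = norm v ^ (a2 + 2 * b2)"
    using assms by (simp add: mixed_PB_mu_def powr_powr powr_realpow [symmetric])
  hence "mixed_power a1 b1 (sheet_root a1 a2 b1 b2 v)
         = of_real (norm v ^ (a2 + 2 * b2)) * cis (real a2 * Arg v)"
    using assms by (simp only: sheet_root_def mixed_power_polar) simp
  also have "\<dots> = mixed_power a2 b2 (of_real (norm v) * cis (Arg v))"
    by (simp add: mixed_power_polar)
  also have "of_real (norm v) * cis (Arg v) = v"
    using rcis_cmod_Arg[of v] by (simp add: rcis_def)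
  finally show ?thesis .
qed

lemma norm_sheet_root: "norm (sheet_root a1 a2 b1 b2 v) = norm v powr mixed_PB_mu a1 a2 b1 b2"
  by (simp add: sheet_root_def norm_mult)

lemma sheet_root_of_real:
  "r > 0 \<Longrightarrow> sheet_root a1 a2 b1 b2 (of_real r) = of_real (r powr mixed_PB_mu a1 a2 b1 b2)"
  by (simp add: sheet_root_def)

lemma continuous_on_sheet_root: "continuous_on {v. Re v > 0} (sheet_root a1 a2 b1 b2)"
  unfolding sheet_root_def
  by (intro continuous_intros) (auto simp: complex_nonpos_Reals_iff)

text \<open>
  Dividing \<open>z\<^sub>1\<close> by the chosen branch at \<open>z\<^sub>2\<close> gives a continuous function on the part of the surface
  over the right half-plane.  By the equation its values are among the finitely many unimodular
  roots of \<open>-1\<close>, so that it is constant on connected sets: it is the label of the sheet.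
\<close>
lemma connected_same_sheet:
  assumes "connected S" and "S \<subseteq> mixed_PB_surface a1 a2 b1 b2" and "a1 > 0" and "a2 > 0"
    and re: "\<And>z. z \<in> S \<Longrightarrow> Re (snd z) > 0"
    and p: "(x, z2) \<in> S" "(y, z2) \<in> S"
  shows "x = y"
proof -
  define h where "h z = fst z / sheet_root a1 a2 b1 b2 (snd z)" for z
  have ne: "sheet_root a1 a2 b1 b2 (snd z) \<noteq> 0" if "z \<in> S" for z
    using re[OF that] by (auto simp: sheet_root_def)
  have "continuous_on S h"
    unfolding h_def using ne re
    by (intro continuous_intros continuous_on_compose2[OF continuous_on_sheet_root]) auto
  moreover have "finite (h ` S)"
  proof (rule finite_subset)
    show "h ` S \<subseteq> {u. norm u = 1 \<and> mixed_power a1 b1 u = -1}"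
    proof clarify
      fix z1 z2 assume z: "(z1, z2) \<in> S"
      have nz: "z2 \<noteq> 0"
        using re[OF z] by auto
      have X: "(z1, z2) \<in> mixed_PB_surface a1 a2 b1 b2"
        using z assms(2) by auto
      have z1: "z1 = h (z1, z2) * sheet_root a1 a2 b1 b2 z2"
        using ne[OF z] by (simp add: h_def)
      have "mixed_power a1 b1 (h (z1, z2)) * mixed_power a2 b2 z2 = - mixed_power a2 b2 z2"
        using X nz assms(3) unfolding mem_mixed_PB_surface_iff
        by (metis mixed_power_mult mixed_power_sheet_root z1)
      hence "(mixed_power a1 b1 (h (z1, z2)) + 1) * mixed_power a2 b2 z2 = 0"
        by (simp add: algebra_simps)
      hence "mixed_power a1 b1 (h (z1, z2)) + 1 = 0"
        using nz assms(4) by (auto simp: mixed_power_eq_0_iff)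
      moreover have "norm (h (z1, z2)) = 1"
        using norm_fst_eq_powr[OF X assms(3,4)] nz by (simp add: h_def norm_divide norm_sheet_root)
      ultimately show "norm (h (z1, z2)) = 1 \<and> mixed_power a1 b1 (h (z1, z2)) = -1"
        by (simp add: eq_neg_iff_add_eq_0)
    qed
    show "finite {u. norm u = 1 \<and> mixed_power a1 b1 u = -1}"
      using assms(3) by (intro finite_mixed_power_roots) auto
  qed
  ultimately have "h constant_on S"
    using assms(1) continuous_finite_range_constant by blast
  hence "h (x, z2) = h (y, z2)"
    using p by (metis constant_on_def)
  thus ?thesis
    using ne[OF p(1)] by (simp add: h_def)
qed

text \<open>
  Two points of the surface over the same \<open>z\<^sub>2\<close> differ by a unimodular root of 1 in the first
  coordinate, and the roots of 1 are isolated.  The gap is relative to \<open>norm x\<close>, hence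
  it is uniform as the points approach the origin.
\<close>
lemma sheet_gap:
  assumes "a1 > 0" and "a2 > 0"
  obtains \<eta> where "\<eta> > 0"
    "\<And>x y z2. \<lbrakk>(x, z2) \<in> mixed_PB_surface a1 a2 b1 b2; (y, z2) \<in> mixed_PB_surface a1 a2 b1 b2;
        norm (y - x) < \<eta> * norm x\<rbrakk> \<Longrightarrow> x = y"
proof -
  obtain \<eta> where \<eta>: "\<eta> > 0"
      "\<And>u. norm u = 1 \<Longrightarrow> mixed_power a1 b1 u = 1 \<Longrightarrow> u \<noteq> 1 \<Longrightarrow> \<eta> \<le> dist 1 u"
    using finite_set_avoid[OF finite_mixed_power_roots[of a1 1 b1], of 1] assms by auto
  show ?thesis
  proof (rule that[OF \<eta>(1)], rule ccontr)
    fix x y z2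
    assume X: "(x, z2) \<in> mixed_PB_surface a1 a2 b1 b2" "(y, z2) \<in> mixed_PB_surface a1 a2 b1 b2"
      and less: "norm (y - x) < \<eta> * norm x" and "x \<noteq> y"
    have x: "x \<noteq> 0"
      using less by auto
    have "mixed_power a1 b1 (y / x) * mixed_power a1 b1 x = mixed_power a1 b1 x"
      using X x unfolding mixed_power_mult [symmetric] by (simp add: mem_mixed_PB_surface_iff)
    hence "mixed_power a1 b1 (y / x) = 1"
      using x assms by (simp add: mixed_power_eq_0_iff)
    moreover have "norm (y / x) = 1"
      using norm_fst_eq_powr[OF X(1) assms] norm_fst_eq_powr[OF X(2) assms] x
      by (metis div_self norm_divide norm_eq_zero)
    ultimately have "\<eta> \<le> dist 1 (y / x)"
      using \<eta>(2) x \<open>x \<noteq> y\<close> by auto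
    also have "dist 1 (y / x) = norm (y - x) / norm x"
      using x by (simp add: dist_norm norm_minus_commute field_simps flip: norm_divide)
    finally show False
      using less x by (simp add: field_simps)
  qed
qed

text \<open>
  The maps \<open>(w\<^sub>1, w\<^sub>2) \<mapsto> (w\<^sub>1 \<cdot> sheet_root v, w\<^sub>2 \<cdot> v)\<close> preserve the surface.  Applied to \<open>p\<close>, with \<open>v\<close> in a small
  disc around 1, they sweep out the piece of the sheet through \<open>p\<close> that lies over a disc around
  \<open>w\<^sub>2\<close>.  If the distance from \<open>q\<close> to \<open>p\<close> is small compared with \<open>norm (fst p)\<close>, which is the scale
  of the gap between the sheets, then \<open>q\<close> cannot be on another sheet and is swept out as well.  The
  constant \<open>\<delta>\<close> does not depend on the size of \<open>p\<close> because the construction is homogeneous.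
\<close>
lemma close_points_connected:
  assumes "mixed_PB_mu a1 a2 b1 b2 \<ge> 1" and "a1 > 0" and "a2 > 0" and "\<kappa> > 0"
  obtains \<delta> where "\<delta> > 0"
    "\<And>p q. \<lbrakk>p \<in> mixed_PB_surface a1 a2 b1 b2; q \<in> mixed_PB_surface a1 a2 b1 b2;
        snd p \<noteq> 0; norm (snd p) \<le> 1; dist p q \<le> \<delta> * norm (fst p)\<rbrakk>
      \<Longrightarrow> \<exists>S. connected S \<and> S \<subseteq> mixed_PB_surface a1 a2 b1 b2 \<and> p \<in> S \<and> q \<in> S \<and>
            (\<forall>s\<in>S. dist p s \<le> \<kappa> * norm (snd p))"
proof -
  define X where "X = mixed_PB_surface a1 a2 b1 b2"
  define g where "g = sheet_root a1 a2 b1 b2"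
  obtain \<eta> where \<eta>: "\<eta> > 0"
    "\<And>x y z2. (x, z2) \<in> X \<Longrightarrow> (y, z2) \<in> X \<Longrightarrow> norm (y - x) < \<eta> * norm x \<Longrightarrow> x = y"
    using sheet_gap[OF assms(2,3)] unfolding X_def by metis
  \<comment> \<open>The bound \<open>1 / 2\<close> keeps \<open>g v\<close> away from 0 and \<open>v\<close> in the right half-plane, \<open>\<eta> / 8\<close> is for the
    comparison with the gap, and \<open>\<kappa> / 2\<close> bounds the displacement in each of the two coordinates.\<close>
  define e where "e = Min {1 / 2, \<eta> / 8, \<kappa> / 2}"
  have e: "e > 0" "e \<le> 1 / 2" "e \<le> \<eta> / 8" "e \<le> \<kappa> / 2"
    using \<eta>(1) assms(4) by (auto simp: e_def)
  have g1: "g 1 = 1"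
    using sheet_root_of_real[of 1] by (simp add: g_def)
  have "continuous_on {v. Re v > 0} g"
    unfolding g_def by (rule continuous_on_sheet_root)
  moreover have "open {v. Re v > 0}"
    by (rule open_halfspace_Re_gt)
  ultimately have "isCont g 1"
    by (simp add: continuous_on_eq_continuous_at)
  then obtain \<delta>0 where \<delta>0: "\<delta>0 > 0" "\<And>v. dist v 1 < \<delta>0 \<Longrightarrow> dist (g v) 1 < e"
    using e(1) unfolding continuous_at_eps_delta g1 by blast
  define d where "d = min \<delta>0 e"
  have d: "d > 0" "d \<le> \<delta>0" "d \<le> e"
    using \<delta>0(1) e(1) by (auto simp: d_def)
  have gv: "norm (g v - 1) < e" "Re v > 0" if "v \<in> ball 1 d" for v
  proof -
    show "norm (g v - 1) < e"
      using \<delta>0(2)[of v] that d by (simp add: dist_commute flip: dist_norm)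
    have "\<bar>Re (1 - v)\<bar> \<le> norm (1 - v)"
      by (rule abs_Re_le_cmod)
    also have "\<dots> < 1"
      using that d e by (simp add: dist_norm)
    finally show "Re v > 0"
      by simp
  qed
  show ?thesis
  proof (rule that[of "d / 2"])
    show "d / 2 > 0"
      using d by simp
    fix p q assume p: "p \<in> mixed_PB_surface a1 a2 b1 b2" and q: "q \<in> mixed_PB_surface a1 a2 b1 b2"
      and nz: "snd p \<noteq> 0" and le1: "norm (snd p) \<le> 1" and dist: "dist p q \<le> d / 2 * norm (fst p)"
    define w1 where "w1 = fst p"
    define w2 where "w2 = snd p"
    define x1 where "x1 = fst q"
    define x2 where "x2 = snd q"
    note defs = w1_def w2_def x1_def x2_def
    have pX: "(w1, w2) \<in> X" and qX: "(x1, x2) \<in> X"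
      using p q by (simp_all add: X_def defs)
    have w2: "w2 \<noteq> 0" "norm w2 \<le> 1"
      using nz le1 by (simp_all add: defs)
    have nw1: "norm w1 = norm w2 powr mixed_PB_mu a1 a2 b1 b2"
      using norm_fst_eq_powr[OF pX[unfolded X_def] assms(2,3)] .
    have w1: "w1 \<noteq> 0"
      using nw1 w2 by auto
    have "norm w2 powr mixed_PB_mu a1 a2 b1 b2 \<le> norm w2 powr 1"
      using w2 assms(1) by (intro powr_mono') auto
    hence le: "norm w1 \<le> norm w2"
      using nw1 by simp
    have d1: "norm (x1 - w1) \<le> d / 2 * norm w1"
      using dist dist_fst_le[of p q] by (simp add: defs dist_norm norm_minus_commute)
    have "norm (x2 - w2) \<le> d / 2 * norm w1"
      using dist dist_snd_le[of p q] by (simp add: defs dist_norm norm_minus_commute)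
    also have "\<dots> \<le> d / 2 * norm w2"
      using le d by (intro mult_left_mono) auto
    also have "\<dots> < d * norm w2"
      using d w2 by simp
    finally have d2: "norm (x2 - w2) < d * norm w2" .
    define F where "F v = (w1 * g v, w2 * v)" for v
    define v where "v = x2 / w2"
    have v: "v \<in> ball 1 d"
    proof -
      have "dist 1 v = norm (x2 - w2) / norm w2"
        using w2 by (simp add: v_def dist_norm norm_minus_commute field_simps flip: norm_divide)
      also have "\<dots> < d"
        using d2 w2 by (simp add: field_simps)
      finally show ?thesis by simp
    qed
    have FX: "F u \<in> X" if "u \<in> ball 1 d" for u
    proof -
      have "u \<noteq> 0"
        using gv(2)[OF that] by auto
      thus ?thesis
        using pX assms(2) by (simp add: F_def X_def g_def mem_mixed_PB_surface_iff mixed_power_mult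
            mixed_power_sheet_root)
    qed
    \<comment> \<open>The points of the surface over \<open>x2\<close> with these first coordinates are closer to each other
      than different sheets can be.\<close>
    have "x1 = w1 * g v"
    proof (rule \<eta>(2)[symmetric])
      show "(w1 * g v, x2) \<in> X"
        using FX[OF v] w2 by (simp add: F_def v_def)
      show "(x1, x2) \<in> X"
        by (rule qX)
      have "norm (x1 - w1 * g v) = norm ((x1 - w1) - w1 * (g v - 1))"
        by (simp add: algebra_simps)
      also have "\<dots> \<le> norm (x1 - w1) + norm w1 * norm (g v - 1)"
        by (metis norm_triangle_ineq4 norm_mult)
      also have "\<dots> \<le> d / 2 * norm w1 + norm w1 * e"
        using d1 gv(1)[OF v] by (intro add_mono mult_left_mono) auto
      also have "\<dots> = (d / 2 + e) * norm w1"
        by (simp add: algebra_simps)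
      also have "\<dots> < (\<eta> * (1 / 2)) * norm w1"
        using d e \<eta>(1) w1 by (intro mult_strict_right_mono) auto
      also have "\<dots> \<le> \<eta> * norm (w1 * g v)"
      proof -
        have "1 \<le> norm (g v) + norm (g v - 1)"
          using norm_triangle_ineq4[of "g v" "g v - 1"] by simp
        hence "norm (g v) \<ge> 1 / 2"
          using gv(1)[OF v] e by linarith
        hence "(1 / 2) * norm w1 \<le> norm (g v) * norm w1"
          by (rule mult_right_mono) simp
        thus ?thesis
          using \<eta>(1) by (simp add: norm_mult mult_ac)
      qed
      finally show "norm (x1 - w1 * g v) < \<eta> * norm (w1 * g v)" .
    qed
    hence Fv: "F v = q"
      using w2 by (simp add: F_def v_def prod_eq_iff flip: x1_def x2_def)
    have F1: "F 1 = p"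
      by (simp add: F_def g1 defs)
    have "continuous_on (ball 1 d) F"
      unfolding F_def g_def using gv(2)
      by (intro continuous_intros continuous_on_subset[OF continuous_on_sheet_root]) auto
    hence "connected (F ` ball 1 d)"
      by (intro connected_continuous_image connected_ball)
    moreover have "dist p (F u) \<le> \<kappa> * norm (snd p)" if u: "u \<in> ball 1 d" for u
    proof -
      have "dist p (F u) \<le> dist w1 (w1 * g u) + dist w2 (w2 * u)"
        using norm_Pair_le[of "w1 - w1 * g u" "w2 - w2 * u"]
        by (simp add: dist_norm F_def defs minus_prod_def)
      also have "dist w1 (w1 * g u) = norm w1 * norm (g u - 1)"
        by (simp add: dist_norm norm_minus_commute algebra_simps flip: norm_mult)
      also have "dist w2 (w2 * u) = norm w2 * norm (u - 1)"
        by (simp add: dist_norm norm_minus_commute algebra_simps flip: norm_mult)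
      also have "norm w1 * norm (g u - 1) + norm w2 * norm (u - 1) \<le> norm w2 * e + norm w2 * e"
        using gv(1)[OF u] le u d
        by (intro add_mono mult_mono) (auto simp: dist_norm norm_minus_commute)
      also have "\<dots> = (2 * e) * norm w2"
        by simp
      also have "\<dots> \<le> \<kappa> * norm w2"
        using e by (intro mult_right_mono) auto
      finally show ?thesis by (simp add: defs)
    qed
    ultimately show "\<exists>S. connected S \<and> S \<subseteq> mixed_PB_surface a1 a2 b1 b2 \<and> p \<in> S \<and> q \<in> S \<and>
            (\<forall>s\<in>S. dist p s \<le> \<kappa> * norm (snd p))"
      using FX imageI[OF v, of F] imageI[of 1 "ball 1 d" F] d(1) unfolding Fv F1 X_def [symmetric]
      by (intro exI[of _ "F ` ball 1 d"]) auto
  qed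
qed

section \<open>Comparing two surfaces\<close>

text \<open>
  For an exponent at least 1 the first coordinate is dominated by the second one on the unit disc,
  so near the origin the distance to the origin may be measured by \<open>z\<^sub>2\<close> alone.
\<close>
lemma norm_le_twice_norm_snd:
  assumes "(z1, z2) \<in> mixed_PB_surface a1 a2 b1 b2" and "a1 > 0" and "a2 > 0"
    and "mixed_PB_mu a1 a2 b1 b2 \<ge> 1" and "norm z2 \<le> 1"
  shows "norm (z1, z2) \<le> 2 * norm z2"
proof -
  have "norm z1 \<le> norm z2 powr 1"
    using norm_fst_eq_powr[OF assms(1-3)] powr_mono'[of 1 "mixed_PB_mu a1 a2 b1 b2" "norm z2"]
      assms(4,5) by simp
  thus ?thesis
    using norm_Pair_le[of z1 z2] by simp
qed

text \<open>
  The arguments \<open>\<pi> / a1\<close> and \<open>- \<pi> / a1\<close> both give roots of \<open>-1\<close>; they are different roots precisely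
  because \<open>a1 \<ge> 2\<close>, the sine of \<open>\<pi> / a1\<close> being positive.
\<close>
lemma two_sheets:
  assumes "a1 \<ge> 2" and "r > 0"
  obtains x y where "x \<noteq> y"
    "(x, of_real r) \<in> mixed_PB_surface a1 a2 b1 b2" "(y, of_real r) \<in> mixed_PB_surface a1 a2 b1 b2"
    "norm (x - y) \<le> 2 * r powr mixed_PB_mu a1 a2 b1 b2"
proof -
  define s where "s = r powr mixed_PB_mu a1 a2 b1 b2"
  define t where "t = pi / real a1"
  have s: "s > 0"
    using assms by (simp add: s_def)
  have root: "(of_real s * cis u, of_real r) \<in> mixed_PB_surface a1 a2 b1 b2"
    if "cis (real a1 * u) = -1" for u
  proof -
    have "mixed_power a1 b1 (of_real s) = mixed_power a2 b2 (of_real r)"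
      using mixed_power_sheet_root[of "of_real r" a1 b1 a2 b2] assms
      by (simp add: sheet_root_of_real s_def)
    moreover have "mixed_power a1 b1 (cis u) = -1"
      using mixed_power_polar[of a1 b1 1 u] that by simp
    ultimately show ?thesis
      by (simp add: mem_mixed_PB_surface_iff mixed_power_mult)
  qed
  show ?thesis
  proof (rule that)
    have "sin t > 0"
      using assms by (intro sin_gt_zero) (auto simp: t_def field_simps)
    hence "Im (cis t) \<noteq> Im (cis (-t))"
      by simp
    thus "of_real s * cis t \<noteq> of_real s * cis (-t)"
      using s by (metis mult_left_cancel of_real_eq_0_iff less_irrefl)
    show "(of_real s * cis t, of_real r) \<in> mixed_PB_surface a1 a2 b1 b2"
      using assms by (intro root) (simp add: t_def)
    show "(of_real s * cis (-t), of_real r) \<in> mixed_PB_surface a1 a2 b1 b2"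
      using assms by (intro root) (simp add: t_def cis_cnj [symmetric])
    show "norm (of_real s * cis t - of_real s * cis (-t)) \<le> 2 * r powr mixed_PB_mu a1 a2 b1 b2"
      using norm_triangle_ineq4[of "of_real s * cis t" "of_real s * cis (-t)"] s
      by (simp add: norm_mult flip: s_def)
  qed
qed

text \<open>
  The comparison of the two scales \<open>r powr \<mu>\<close> and \<open>r powr \<nu>\<close>: points on different sheets of the
  source that are close for the outer metric must have images on the same sheet of the target, and
  the short connection between the images pulls back to one between the points.
\<close>
lemma no_bilipschitz_germ_homeomorphism:
  fixes \<phi> \<psi> :: "complex \<times> complex \<Rightarrow> complex \<times> complex"
    and a1 a2 b1 b2 c1 c2 d1 d2 :: nat
  defines "X \<equiv> mixed_PB_surface a1 a2 b1 b2" and "Y \<equiv> mixed_PB_surface c1 c2 d1 d2"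
  assumes "a1 \<ge> 2" and "a2 > 0" and "c1 > 0" and "c2 > 0"
    and mu: "1 \<le> mixed_PB_mu c1 c2 d1 d2" "mixed_PB_mu c1 c2 d1 d2 < mixed_PB_mu a1 a2 b1 b2"
    and U: "open U" "0 \<in> U" and V: "open V" "0 \<in> V" and \<phi>0: "\<phi> 0 = 0"
    and hom: "homeomorphism (X \<inter> U) (Y \<inter> V) \<phi> \<psi>"
    and lip: "L-lipschitz_on (X \<inter> U) \<phi>" "M-lipschitz_on (Y \<inter> V) \<psi>"
  shows False
proof -
  define \<mu> where "\<mu> = mixed_PB_mu a1 a2 b1 b2"
  define \<nu> where "\<nu> = mixed_PB_mu c1 c2 d1 d2"
  have \<mu>\<nu>: "1 \<le> \<nu>" "\<nu> < \<mu>"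
    using mu by (simp_all add: \<mu>_def \<nu>_def)
  have a1: "a1 > 0"
    using assms(3) by simp
  obtain u where u: "u > 0" "ball 0 u \<subseteq> U"
    using U open_contains_ball by blast
  obtain v where v: "v > 0" "ball 0 v \<subseteq> V"
    using V open_contains_ball by blast
  have LM: "L \<ge> 0" "M \<ge> 0"
    using lip lipschitz_on_nonneg by blast+
  define K where "K = 1 + L + M"
  have K: "K \<ge> 1" "L \<le> K" "M \<le> K"
    using LM by (auto simp: K_def)
  \<comment> \<open>A set within \<open>\<kappa> * norm (snd q) \<le> \<kappa> * (2 * K * r)\<close> of \<open>q\<close> is pulled back to one within
    \<open>K * \<kappa> * (2 * K * r) = r / 2\<close> of \<open>p\<close>.\<close>
  define \<kappa> where "\<kappa> = 1 / (4 * K\<^sup>2)"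
  have \<kappa>: "\<kappa> > 0" "\<kappa> \<le> 1"
  proof -
    have "1 \<le> 4 * K\<^sup>2"
      using one_le_power[OF K(1), of 2] by linarith
    thus "\<kappa> > 0" "\<kappa> \<le> 1"
      using K by (simp_all add: \<kappa>_def)
  qed
  obtain \<delta> where \<delta>: "\<delta> > 0"
    "\<And>p q. \<lbrakk>p \<in> Y; q \<in> Y; snd p \<noteq> 0; norm (snd p) \<le> 1; dist p q \<le> \<delta> * norm (fst p)\<rbrakk>
      \<Longrightarrow> \<exists>S. connected S \<and> S \<subseteq> Y \<and> p \<in> S \<and> q \<in> S \<and> (\<forall>s\<in>S. dist p s \<le> \<kappa> * norm (snd p))"
    using close_points_connected[OF mu(1) assms(5,6) \<kappa>(1)] unfolding Y_def by metis
  have ev: "eventually (\<lambda>r. r < B) (at_right (0::real))" if "B > 0" for B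
    using that by (auto simp: eventually_at_right)
  have "((\<lambda>r. 2 * K * r powr (\<mu> - \<nu>)) \<longlongrightarrow> 2 * K * 0 powr (\<mu> - \<nu>)) (at_right 0)"
    using \<mu>\<nu> by (intro tendsto_intros tendsto_powr') (auto simp: eventually_at_right_less
        intro: eventually_mono[OF eventually_at_right_less])
  \<comment> \<open>The strict inequality between the two exponents enters here.  Multiplied by \<open>r powr \<nu>\<close>, the left
    side bounds the distance of the images, and the right side is \<open>\<delta>\<close> times the lower bound for
    \<open>norm (fst q)\<close> that comes from \<open>norm (snd q) \<ge> r / (2 * K)\<close>.\<close>
  hence "eventually (\<lambda>r. 2 * K * r powr (\<mu> - \<nu>) < \<delta> * (1 / (2 * K)) powr \<nu>) (at_right 0)"
    using K \<delta>(1) by (intro order_tendstoD) auto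
  with ev[of 1] ev[of "u / 2"] ev[of "v / (4 * K)"] ev[of "1 / (2 * K)"] u v K
  have "eventually (\<lambda>r. r < 1 \<and> r < u / 2 \<and> r < v / (4 * K) \<and> r < 1 / (2 * K) \<and> 0 < r \<and>
      2 * K * r powr (\<mu> - \<nu>) < \<delta> * (1 / (2 * K)) powr \<nu>) (at_right 0)"
    by (auto intro!: eventually_conj simp: eventually_at_right_less)
  then obtain r where r: "0 < r" "r < 1" "r < u / 2" "r < v / (4 * K)" "r < 1 / (2 * K)"
      "2 * K * r powr (\<mu> - \<nu>) < \<delta> * (1 / (2 * K)) powr \<nu>"
    using eventually_happens'[OF trivial_limit_at_right_real] by blast
  obtain x y where xy: "x \<noteq> y" "(x, of_real r) \<in> X" "(y, of_real r) \<in> X"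
      "norm (x - y) \<le> 2 * r powr \<mu>"
    using two_sheets[OF assms(3) r(1)] unfolding X_def \<mu>_def by metis
  define p where "p = (x, complex_of_real r)"
  define p' where "p' = (y, complex_of_real r)"
  have inX: "z \<in> X \<inter> U" and norm_le: "norm z \<le> 2 * r" if "z = p \<or> z = p'" for z
  proof -
    have z: "z \<in> X" "snd z = of_real r"
      using that xy by (auto simp: p_def p'_def)
    hence "(fst z, of_real r) \<in> X"
      by (metis prod.collapse)
    hence "norm (fst z, complex_of_real r) \<le> 2 * norm (complex_of_real r)"
      using r(1,2) mu assms(4) a1 by (intro norm_le_twice_norm_snd[of _ _ a1 a2 b1 b2]) (auto simp: X_def)
    thus *: "norm z \<le> 2 * r"
      using z r(1) by (metis abs_of_pos norm_of_real prod.collapse)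
    thus "z \<in> X \<inter> U"
      using z u r(3) by (intro IntI subsetD[OF u(2)]) auto
  qed
  have 0: "0 \<in> X \<inter> U" "0 \<in> Y \<inter> V"
    using U V a1 assms(4-6)
    by (auto simp: X_def Y_def zero_prod_def mem_mixed_PB_surface_iff mixed_power_def power_0_left)
  have \<psi>0: "\<psi> 0 = 0"
    using hom 0 \<phi>0 by (metis homeomorphism_apply1)
  define q where "q = \<phi> p"
  define q' where "q' = \<phi> p'"
  have qY: "q \<in> Y \<inter> V" "q' \<in> Y \<inter> V" and \<psi>q: "\<psi> q = p" "\<psi> q' = p'"
    using hom inX[of p] inX[of p'] unfolding q_def q'_def homeomorphism_def by auto
  have nq: "norm q \<le> 2 * K * r"
  proof -
    have "norm q \<le> L * norm p"
      using lipschitz_onD(1)[OF lip(1), of p 0] inX[of p] 0 \<phi>0 by (simp add: q_def)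
    also have "\<dots> \<le> K * (2 * r)"
      using norm_le[of p] K LM by (intro mult_mono) auto
    finally show ?thesis by simp
  qed
  have sq: "norm (snd q) \<le> 2 * K * r"
    using nq norm_snd_le[of "snd q" "fst q"] by simp
  have "2 * K * r < 1"
    using r K by (simp add: field_simps)
  hence sq1: "norm (snd q) \<le> 1"
    using sq by linarith
  have sq_ge: "norm (snd q) \<ge> r / (2 * K)"
  proof -
    have "r \<le> norm p"
      using norm_snd_le[of "complex_of_real r" x] r(1) by (simp add: p_def)
    also have "\<dots> \<le> M * norm q"
      using lipschitz_onD(1)[OF lip(2), of q 0] qY 0 \<psi>0 \<psi>q by simp
    also have "\<dots> \<le> K * (2 * norm (snd q))"
      using norm_le_twice_norm_snd[of "fst q" "snd q" c1 c2 d1 d2] qY assms(5,6) mu sq1 K LM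
      by (intro mult_mono) (auto simp: Y_def)
    finally show ?thesis
      using K by (simp add: field_simps)
  qed
  have "dist q q' \<le> \<delta> * norm (fst q)"
  proof -
    have "dist p p' = norm (x - y)"
      by (simp add: p_def p'_def dist_prod_def dist_norm)
    hence "dist q q' \<le> L * norm (x - y)"
      using lipschitz_onD(1)[OF lip(1), of p p'] inX by (simp add: q_def q'_def)
    also have "\<dots> \<le> K * (2 * r powr \<mu>)"
      using xy(4) K LM by (intro mult_mono) auto
    also have "\<dots> = (2 * K * r powr (\<mu> - \<nu>)) * r powr \<nu>"
      using r(1) by (simp flip: powr_add)
    also have "\<dots> \<le> (\<delta> * (1 / (2 * K)) powr \<nu>) * r powr \<nu>"
      using r(6) by (intro mult_right_mono) auto
    also have "\<dots> = \<delta> * (r / (2 * K)) powr \<nu>"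
      using r(1) K by (simp add: powr_divide)
    also have "\<dots> \<le> \<delta> * norm (snd q) powr \<nu>"
      using \<delta>(1) sq_ge r(1) K \<mu>\<nu> by (intro mult_left_mono powr_mono2) auto
    also have "norm (snd q) powr \<nu> = norm (fst q)"
      using norm_fst_eq_powr[of "fst q" "snd q" c1 c2 d1 d2] qY assms(5,6) by (simp add: Y_def \<nu>_def)
    finally show ?thesis .
  qed
  moreover have "norm (snd q) > 0"
    using sq_ge r(1) K by (intro less_le_trans[OF _ sq_ge]) simp
  hence "snd q \<noteq> 0"
    by simp
  ultimately obtain S where S: "connected S" "S \<subseteq> Y" "q \<in> S" "q' \<in> S"
      "\<And>s. s \<in> S \<Longrightarrow> dist q s \<le> \<kappa> * norm (snd q)"
    using \<delta>(2)[of q q'] qY sq1 by blast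
  have SV: "S \<subseteq> Y \<inter> V"
  proof
    fix s assume s: "s \<in> S"
    have "norm s \<le> norm q + dist q s"
      using norm_triangle_ineq4[of q "q - s"] by (simp add: dist_norm)
    also have "dist q s \<le> 1 * norm (snd q)"
      using S(5)[OF s] \<kappa> mult_right_mono[of \<kappa> 1 "norm (snd q)"] by simp
    also have "norm q + 1 * norm (snd q) \<le> 4 * K * r"
      using nq sq by simp
    also have "\<dots> < v"
      using r(4) K by (simp add: field_simps)
    finally show "s \<in> Y \<inter> V"
      using s S(2) v(2) by auto
  qed
  have "x = y"
  proof (rule connected_same_sheet)
    have "continuous_on S \<psi>"
      using hom SV by (meson continuous_on_subset homeomorphism_cont2)
    thus "connected (\<psi> ` S)"
      using S(1) connected_continuous_image by blast
    show "\<psi> ` S \<subseteq> mixed_PB_surface a1 a2 b1 b2"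
      using hom SV unfolding homeomorphism_def X_def by blast
    show "(x, of_real r) \<in> \<psi> ` S" "(y, of_real r) \<in> \<psi> ` S"
      using S(3,4) \<psi>q by (force simp: p_def p'_def)+
    show "Re (snd z) > 0" if z: "z \<in> \<psi> ` S" for z
    proof -
      obtain s where s: "s \<in> S" "z = \<psi> s"
        using z by blast
      have "r - Re (snd z) \<le> norm (snd (p - z))"
        using complex_Re_le_cmod[of "snd (p - z)"] by (simp add: p_def)
      also have "\<dots> \<le> dist p z"
        using norm_snd_le[of "snd (p - z)" "fst (p - z)"] by (simp only: prod.collapse dist_norm)
      also have "\<dots> \<le> M * dist q s"
        using lipschitz_onD(1)[OF lip(2), of q s] SV S(3) s \<psi>q by auto
      also have "\<dots> \<le> K * (\<kappa> * (2 * K * r))"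
        using order_trans[OF S(5)[OF s(1)] mult_left_mono[OF sq]] K LM \<kappa>
        by (intro mult_mono) auto
      also have "\<dots> = r / 2"
        using K by (simp add: \<kappa>_def power2_eq_square)
      finally show ?thesis
        using r(1) by simp
    qed
  qed (use a1 assms(4) in auto)
  with xy(1) show False ..
qed

theorem theorem6p8:
  fixes a1 a2 b1 b2 c1 c2 d1 d2 :: nat
  assumes "mixed_PB_type1 a1 a2 b1 b2"
    and "mixed_PB_type1 c1 c2 d1 d2"
    and "a1 \<ge> 2"
    and "mixed_PB_mu c1 c2 d1 d2 < mixed_PB_mu a1 a2 b1 b2"
  shows "\<nexists>\<phi>. subanalytic_bilipschitz_germ_homeomorphism
                (mixed_PB_surface a1 a2 b1 b2) (mixed_PB_surface c1 c2 d1 d2) \<phi>"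
proof
  assume "\<exists>\<phi>. subanalytic_bilipschitz_germ_homeomorphism
                (mixed_PB_surface a1 a2 b1 b2) (mixed_PB_surface c1 c2 d1 d2) \<phi>"
  then obtain \<phi> \<psi> U V L M where
    "open U" "0 \<in> U" "open V" "0 \<in> V" "\<phi> 0 = 0"
    "homeomorphism (mixed_PB_surface a1 a2 b1 b2 \<inter> U) (mixed_PB_surface c1 c2 d1 d2 \<inter> V) \<phi> \<psi>"
    "L-lipschitz_on (mixed_PB_surface a1 a2 b1 b2 \<inter> U) \<phi>"
    "M-lipschitz_on (mixed_PB_surface c1 c2 d1 d2 \<inter> V) \<psi>"
    unfolding subanalytic_bilipschitz_germ_homeomorphism_def bilipschitz_homeomorphism_def by blast
  moreover have "a2 > 0" "c1 > 0" "c2 > 0" "1 \<le> mixed_PB_mu c1 c2 d1 d2"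
    using assms(1,2) by (auto simp: mixed_PB_type1_def)
  ultimately show False
    using no_bilipschitz_germ_homeomorphism assms(3,4) by blast
qed

end
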